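(* Let $\mathfrak{g}=\mathfrak{g}_{4.10}$ be the four-dimensional real Lie algebra with basis $\mathcal{B}=\{e_1,e_2,e_3,e_4\}$ whose nonzero Lie brackets (up to skew-symmetry) are $[e_1,e_3]=e_1$, $[e_2,e_3]=e_2$, $[e_1,e_4]=-e_2$, $[e_2,e_4]=e_1$. Let $\langle\cdot,\cdot\rangle$ be a pseudo-Riemannian inner product on $\mathfrak{g}$ and let $(R_{ij})$ be the matrix of its Ricci operator $\operatorname{Ric}$ in the basis $\mathcal{B}$. Then $\langle\cdot,\cdot\rangle$ is an algebraic Ricci soliton if and only if $$R_{31}=R_{41}=R_{32}=0,\quad R_{42}=R_{43}=R_{34}=0,\quad R_{33}=R_{44},\quad R_{22}=R_{11},$$ $$R_{21}=-R_{12},\quad R_{14}=R_{23},\quad R_{24}=-R_{13}.$$ Given these conditions, $\operatorname{Ric}=\eta I_4+D$ where $\eta=R_{44}=R_{33}$ and $$D=\begin{bmatrix}R_{11}-R_{33}&R_{12}&R_{13}&R_{23}\\-R_{12}&R_{11}-R_{33}&R_{23}&-R_{13}\\0&0&0&0\\0&0&0&0\end{bmatrix}$$ is (the matrix in the basis $\mathcal{B}$ of) a derivation of $\mathfrak{g}$.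
   Context: A pseudo-Riemannian inner product on a real Lie algebra $\mathfrak{g}$ is a nondegenerate symmetric bilinear form $\langle\cdot,\cdot\rangle$ on $\mathfrak{g}$ (of some signature $(r,s)$). Its Levi-Civita connection $\nabla$ is defined by $2\langle\nabla_uv,w\rangle=\langle[u,v],w\rangle+\langle[w,u],v\rangle+\langle[w,v],u\rangle$; its curvature is $R_{uv}=\nabla_{[u,v]}-[\nabla_u,\nabla_v]$; its Ricci curvature $\operatorname{ric}(u,v)$ is the trace of $w\mapsto R_{uw}v$; its Ricci operator $\operatorname{Ric}$ is the endomorphism of $\mathfrak{g}$ with $\langle\operatorname{Ric}(u),v\rangle=\operatorname{ric}(u,v)$. The matrix $(R_{ij})$ of $\operatorname{Ric}$ in a basis $\{e_i\}$ is given by $\operatorname{Ric}(e_j)=\sum_iR_{ij}e_i$ (the same column convention is used for $D$). A derivation is a linear map $D:\mathfrak{g}\to\mathfrak{g}$ with $D[x,y]=[D(x),y]+[x,D(y)]$ for all $x,y$. The inner product is an algebraic Ricci soliton if $\operatorname{Ric}=\eta\,\mathrm{Id}_{\mathfrak{g}}+D$ for some $\eta\in\mathbb{R}$ and some derivation $D$ of $\mathfrak{g}$. *)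

theory Defs
  imports "HOL-Analysis.Analysis"
begin

text \<open>
  A real Lie algebra of dimension \<open>CARD('n)\<close> is given by a bracket on \<^typ>\<open>real ^ 'n\<close>.
\<close>

definition lie_bracket :: "(real ^ 'n \<Rightarrow> real ^ 'n \<Rightarrow> real ^ 'n) \<Rightarrow> bool"
  where "lie_bracket br \<longleftrightarrow> bilinear br \<and> (\<forall>x. br x x = 0) \<and>
    (\<forall>x y z. br x (br y z) + br y (br z x) + br z (br x y) = 0)"

definition lie_derivation ::
    "(real ^ 'n \<Rightarrow> real ^ 'n \<Rightarrow> real ^ 'n) \<Rightarrow> (real ^ 'n \<Rightarrow> real ^ 'n) \<Rightarrow> bool"
  where "lie_derivation br D \<longleftrightarrow> linear D \<and> (\<forall>x y. D (br x y) = br (D x) y + br x (D y))"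

definition pseudo_inner_product :: "(real ^ 'n \<Rightarrow> real ^ 'n \<Rightarrow> real) \<Rightarrow> bool"
  where "pseudo_inner_product g \<longleftrightarrow> bilinear g \<and> (\<forall>x y. g x y = g y x) \<and>
    (\<forall>x. (\<forall>y. g x y = 0) \<longrightarrow> x = 0)"

text \<open>
  The two definite descriptions below are justified by \<open>levi_civita_koszul\<close> and
  \<open>ricci_operator_eq\<close>. The sign conventions are
  \<open>R u v = \<nabla>\<^bsub>[u,v]\<^esub> - [\<nabla>\<^sub>u, \<nabla>\<^sub>v]\<close> and \<open>ric u v = tr (w \<mapsto> R u w v)\<close>.
\<close>

definition levi_civita :: "(real ^ 'n \<Rightarrow> real ^ 'n \<Rightarrow> real ^ 'n) \<Rightarrow>
    (real ^ 'n \<Rightarrow> real ^ 'n \<Rightarrow> real) \<Rightarrow> real ^ 'n \<Rightarrow> real ^ 'n \<Rightarrow> real ^ 'n"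
  where "levi_civita br g u v =
    (THE x. \<forall>w. 2 * g x w = g (br u v) w + g (br w u) v + g (br w v) u)"

definition curvature :: "(real ^ 'n \<Rightarrow> real ^ 'n \<Rightarrow> real ^ 'n) \<Rightarrow>
    (real ^ 'n \<Rightarrow> real ^ 'n \<Rightarrow> real) \<Rightarrow> real ^ 'n \<Rightarrow> real ^ 'n \<Rightarrow> real ^ 'n \<Rightarrow> real ^ 'n"
  where "curvature br g u v z = levi_civita br g (br u v) z -
    (levi_civita br g u (levi_civita br g v z) - levi_civita br g v (levi_civita br g u z))"

definition ricci :: "(real ^ 'n \<Rightarrow> real ^ 'n \<Rightarrow> real ^ 'n) \<Rightarrow>
    (real ^ 'n \<Rightarrow> real ^ 'n \<Rightarrow> real) \<Rightarrow> real ^ 'n \<Rightarrow> real ^ 'n \<Rightarrow> real"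
  where "ricci br g u v = trace (matrix (\<lambda>w. curvature br g u w v))"

definition ricci_operator :: "(real ^ 'n \<Rightarrow> real ^ 'n \<Rightarrow> real ^ 'n) \<Rightarrow>
    (real ^ 'n \<Rightarrow> real ^ 'n \<Rightarrow> real) \<Rightarrow> real ^ 'n \<Rightarrow> real ^ 'n"
  where "ricci_operator br g u = (THE x. \<forall>v. g x v = ricci br g u v)"

definition algebraic_ricci_soliton :: "(real ^ 'n \<Rightarrow> real ^ 'n \<Rightarrow> real ^ 'n) \<Rightarrow>
    (real ^ 'n \<Rightarrow> real ^ 'n \<Rightarrow> real) \<Rightarrow> bool"
  where "algebraic_ricci_soliton br g \<longleftrightarrow>
    (\<exists>\<eta> D. lie_derivation br D \<and> (\<forall>x. ricci_operator br g x = \<eta> *\<^sub>R x + D x))"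

text \<open>
  The bilinear extension of the bracket table of \<open>\<gg>\<^sub>4\<^sub>.\<^sub>1\<^sub>0\<close> (lemma \<open>g4_10_table\<close>) in the
  standard basis \<open>e\<^sub>i = axis i 1\<close>. Indices have type \<^typ>\<open>4\<close>, where \<open>4 = 0\<close>; thus
  \<open>1, 2, 3, 4\<close> are the four distinct indices.
\<close>

definition g4_10 :: "real ^ 4 \<Rightarrow> real ^ 4 \<Rightarrow> real ^ 4"
  where "g4_10 x y =
    ((x$1 * y$3 - x$3 * y$1) + (x$2 * y$4 - x$4 * y$2)) *\<^sub>R axis 1 1 +
    ((x$2 * y$3 - x$3 * y$2) - (x$1 * y$4 - x$4 * y$1)) *\<^sub>R axis 2 1"

lemma g4_10_nth:
  "g4_10 x y $ 1 = (x$1 * y$3 - x$3 * y$1) + (x$2 * y$4 - x$4 * y$2)"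
  "g4_10 x y $ 2 = (x$2 * y$3 - x$3 * y$2) - (x$1 * y$4 - x$4 * y$1)"
  "g4_10 x y $ 3 = 0"
  "g4_10 x y $ 4 = 0"
  by (simp_all add: g4_10_def axis_def)

lemma lie_bracket_g4_10: "lie_bracket g4_10"
  unfolding lie_bracket_def bilinear_def linear_iff
  by (intro conjI allI) (simp_all add: vec_eq_iff forall_4 g4_10_nth algebra_simps)

lemma g4_10_table:
  "g4_10 (axis 1 1) (axis 2 1) = 0"
  "g4_10 (axis 1 1) (axis 3 1) = axis 1 1"
  "g4_10 (axis 2 1) (axis 3 1) = axis 2 1"
  "g4_10 (axis 1 1) (axis 4 1) = - axis 2 1"
  "g4_10 (axis 2 1) (axis 4 1) = axis 1 1"
  "g4_10 (axis 3 1) (axis 4 1) = 0"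
  by (simp_all add: g4_10_def axis_def)

lemma vector_4:
  "(vector [a, b, c, d] :: 'a::zero ^ 4) $ 1 = a"
  "(vector [a, b, c, d] :: 'a::zero ^ 4) $ 2 = b"
  "(vector [a, b, c, d] :: 'a::zero ^ 4) $ 3 = c"
  "(vector [a, b, c, d] :: 'a::zero ^ 4) $ 4 = d"
  by (simp_all add: vector_def)

lemma ex1_representing_vector:
  fixes g :: "real ^ 'n \<Rightarrow> real ^ 'n \<Rightarrow> real"
  assumes g: "pseudo_inner_product g" and \<phi>: "linear \<phi>"
  shows "\<exists>!x. \<forall>w. g x w = \<phi> w"
proof -
  have bil: "bilinear g" and nondeg: "\<And>x. (\<forall>y. g x y = 0) \<Longrightarrow> x = 0"
    using g by (auto simp: pseudo_inner_product_def)
  have gl: "linear (g x)" for x using bil by (simp add: bilinear_def)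
  have ext: "f = h" if "linear f" "linear h" "\<And>i. f (axis i 1) = h (axis i 1)"
    for f h :: "real ^ 'n \<Rightarrow> real"
    by (rule linear_eq_stdbasis[OF that(1,2)]) (use that(3) in \<open>auto simp: Basis_vec_def\<close>)
  define f :: "real ^ 'n \<Rightarrow> real ^ 'n" where "f x = (\<chi> i. g x (axis i 1))" for x
  have lf: "linear f"
    by (rule linearI)
      (auto simp: f_def vec_eq_iff bilinear_ladd[OF bil] bilinear_lmul[OF bil])
  have "x = 0" if "f x = 0" for x
  proof (rule nondeg)
    have "g x = (\<lambda>_. 0)"
      by (rule ext[OF gl]) (use that in \<open>auto simp: f_def vec_eq_iff linear_iff\<close>)
    then show "\<forall>y. g x y = 0" by simp
  qed
  then have inj: "inj f" using linear_injective_0[OF lf] by blast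
  then obtain x where "f x = (\<chi> i. \<phi> (axis i 1))"
    using linear_injective_imp_surjective[OF lf inj] by (metis surjD)
  then have "g x = \<phi>" by (intro ext gl \<phi>) (simp add: f_def vec_eq_iff)
  moreover have "x' = x" if "\<forall>w. g x' w = \<phi> w" for x'
    using that \<open>g x = \<phi>\<close> inj by (auto simp: f_def inj_def)
  ultimately show ?thesis by (metis (no_types))
qed

lemma pseudo_inner_product_eqI:
  assumes g: "pseudo_inner_product g" and "\<And>w. g x w = g y w"
  shows "x = y"
proof -
  have "bilinear g" and nondeg: "\<And>x. (\<forall>y. g x y = 0) \<Longrightarrow> x = 0"
    using g by (auto simp: pseudo_inner_product_def)
  have "g (x - y) w = 0" for w
    using bilinear_lsub[OF \<open>bilinear g\<close>, of x y w] assms(2)[of w] by linarith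
  then have "x - y = 0" by (intro nondeg allI)
  then show ?thesis by simp
qed

lemma levi_civita_koszul:
  assumes g: "pseudo_inner_product g" and br: "bilinear br"
  shows "2 * g (levi_civita br g u v) w = g (br u v) w + g (br w u) v + g (br w v) u"
proof -
  have bil: "bilinear g" using g by (simp add: pseudo_inner_product_def)
  have "linear (\<lambda>w. (g (br u v) w + g (br w u) v + g (br w v) u) / 2)"
    by (rule linearI)
      (simp_all add: bilinear_ladd[OF bil] bilinear_lmul[OF bil] bilinear_radd[OF bil]
        bilinear_rmul[OF bil] bilinear_ladd[OF br] bilinear_lmul[OF br] field_simps)
  from ex1_representing_vector[OF g this]
  have "\<exists>!x. \<forall>w. 2 * g x w = g (br u v) w + g (br w u) v + g (br w v) u"
    by (simp add: field_simps)
  from theI'[OF this] show ?thesis by (simp add: levi_civita_def)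
qed

lemma bilinear_levi_civita:
  assumes g: "pseudo_inner_product g" and br: "bilinear br"
  shows "bilinear (levi_civita br g)"
proof -
  have bil: "bilinear g" using g by (simp add: pseudo_inner_product_def)
  note s = bilinear_ladd[OF bil] bilinear_lmul[OF bil] bilinear_radd[OF bil]
    bilinear_rmul[OF bil] bilinear_ladd[OF br] bilinear_lmul[OF br]
    bilinear_radd[OF br] bilinear_rmul[OF br]
  have *: "x = y" if "\<And>w. 2 * g x w = 2 * g y w" for x y
    by (rule pseudo_inner_product_eqI[OF g]) (use that in simp)
  note k = levi_civita_koszul[OF g br]
  have k': "g (levi_civita br g u v) w = (g (br u v) w + g (br w u) v + g (br w v) u) / 2"
    for u v w using k[of u v w] by simp
  show ?thesis
    unfolding bilinear_def
    by (intro conjI allI linearI; rule *) (simp_all add: s k' add_divide_distrib distrib_left)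
qed

lemma bilinear_ricci:
  assumes g: "pseudo_inner_product g" and br: "bilinear br"
  shows "bilinear (ricci br g)"
proof -
  note l = bilinear_levi_civita[OF g br]
  note s = bilinear_ladd[OF l] bilinear_lmul[OF l] bilinear_radd[OF l] bilinear_rmul[OF l]
    bilinear_ladd[OF br] bilinear_lmul[OF br]
  show ?thesis
    unfolding bilinear_def
    by (intro conjI allI linearI)
      (simp_all add: ricci_def curvature_def trace_def matrix_def s algebra_simps
        sum.distrib sum_subtractf sum_distrib_left)
qed

lemma ricci_operator_eq:
  assumes g: "pseudo_inner_product g" and br: "bilinear br"
  shows "g (ricci_operator br g u) v = ricci br g u v"
proof -
  have "linear (ricci br g u)" using bilinear_ricci[OF g br] by (simp add: bilinear_def)
  from theI'[OF ex1_representing_vector[OF g this]] show ?thesis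
    by (simp add: ricci_operator_def)
qed

end

theory Submission
  imports Defs
begin

text \<open>
  Only the linearity of the Ricci operator matters: the derivations of \<open>\<gg>\<^sub>4\<^sub>.\<^sub>1\<^sub>0\<close> map into the derived
  algebra and commute there with the rotation \<open>ad e\<^sub>4\<close>. Their last two rows therefore
  vanish, so \<open>\<eta>\<close> can be read off from the lower right block of the matrix of \<open>Ric\<close>.
\<close>

text \<open>Nondegeneracy of \<open>g\<close> transfers the linearity of \<open>ricci\<close> in its
  first argument to the operator.\<close>

lemma linear_ricci_operator:
  assumes g: "pseudo_inner_product g" and br: "bilinear br"
  shows "linear (ricci_operator br g)"
proof (rule linearI; rule pseudo_inner_product_eqI[OF g])
  have bg: "bilinear g"
    using g by (simp add: pseudo_inner_product_def)
  note s = bilinear_ladd[OF bg] bilinear_lmul[OF bg] ricci_operator_eq[OF g br]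
    bilinear_ladd[OF bilinear_ricci[OF g br]] bilinear_lmul[OF bilinear_ricci[OF g br]]
  show "g (ricci_operator br g (x + y)) w = g (ricci_operator br g x + ricci_operator br g y) w"
    for x y w by (simp add: s)
  show "g (ricci_operator br g (c *\<^sub>R x)) w = g (c *\<^sub>R ricci_operator br g x) w"
    for c x w by (simp add: s)
qed

text \<open>Brackets of e1, e2 with e3 force rows 3 and 4 to vanish in columns 1 to 3. Those with e4
  clear column 4 of these rows and make the upper left block commute with the rotation. Finally
  [e3,e4] = 0 ties column 4 to column 3.\<close>

lemma lie_derivation_g4_10_iff:
  "lie_derivation g4_10 ((*v) M) \<longleftrightarrow>
    M$3 = 0 \<and> M$4 = 0 \<and> M$2$2 = M$1$1 \<and> M$2$1 = - M$1$2 \<and> M$1$4 = M$2$3 \<and> M$2$4 = - M$1$3"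
    (is "?L \<longleftrightarrow> ?R")
proof
  assume ?L
  then have *: "M *v g4_10 (axis i 1) (axis j 1) =
      g4_10 (M *v axis i 1) (axis j 1) + g4_10 (axis i 1) (M *v axis j 1)" for i j
    by (simp add: lie_derivation_def)
  show ?R
    using *[of 1 2] *[of 1 3] *[of 1 4] *[of 2 3] *[of 2 4] *[of 3 4]
    by (simp add: vec_eq_iff forall_4 g4_10_nth matrix_vector_mult_def sum_4 axis_def)
next
  assume ?R
  then show ?L
    by (simp add: lie_derivation_def vec_eq_iff forall_4 g4_10_nth matrix_vector_mult_def sum_4
        algebra_simps)
qed

text \<open>Allows the soliton equation to be compared entry by entry.\<close>

lemma matrix_eq_mat_plus_iff:
  fixes R :: "real ^ 'n ^ 'n"
  assumes "\<And>x. f x = R *v x"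
  shows "(\<forall>x. f x = \<eta> *\<^sub>R x + M *v x) \<longleftrightarrow> R = mat \<eta> + M"
proof -
  have "mat \<eta> *v x = \<eta> *\<^sub>R x" for x :: "real ^ 'n"
    by (simp add: vec_eq_iff matrix_vector_mult_def mat_def if_distrib[of "\<lambda>a. a * _"] cong: if_cong)
  then show ?thesis
    by (simp add: assms matrix_eq matrix_vector_mult_add_rdistrib)
qed

theorem theorem4p12:
  fixes g :: "real ^ 4 \<Rightarrow> real ^ 4 \<Rightarrow> real"
    and R :: "real ^ 4 ^ 4"
  assumes "pseudo_inner_product g"
    and "R = matrix (ricci_operator g4_10 g)"
  shows "let conds =
        (R$3$1 = 0 \<and> R$4$1 = 0 \<and> R$3$2 = 0 \<and>
         R$4$2 = 0 \<and> R$4$3 = 0 \<and> R$3$4 = 0 \<and>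
         R$3$3 = R$4$4 \<and> R$2$2 = R$1$1 \<and>
         R$2$1 = - R$1$2 \<and> R$1$4 = R$2$3 \<and> R$2$4 = - R$1$3);
      \<eta> = R$4$4;
      D = (vector
        [vector [R$1$1 - R$3$3, R$1$2,           R$1$3, R$2$3],
         vector [- R$1$2,       R$1$1 - R$3$3,   R$2$3, - R$1$3],
         vector [0,             0,               0,     0],
         vector [0,             0,               0,     0]] :: real ^ 4 ^ 4)
    in (algebraic_ricci_soliton g4_10 g \<longleftrightarrow> conds) \<and>
       (conds \<longrightarrow>
          \<eta> = R$3$3 \<and>
          R = mat \<eta> + D \<and>
          (\<forall>x. ricci_operator g4_10 g x = \<eta> *\<^sub>R x + D *v x) \<and>
          lie_derivation g4_10 (\<lambda>x. D *v x))"
proof -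
  let ?Ric = "ricci_operator g4_10 g"
  define conds where "conds \<longleftrightarrow>
    R$3$1 = 0 \<and> R$4$1 = 0 \<and> R$3$2 = 0 \<and>
    R$4$2 = 0 \<and> R$4$3 = 0 \<and> R$3$4 = 0 \<and>
    R$3$3 = R$4$4 \<and> R$2$2 = R$1$1 \<and>
    R$2$1 = - R$1$2 \<and> R$1$4 = R$2$3 \<and> R$2$4 = - R$1$3"
  define D :: "real ^ 4 ^ 4" where "D = vector
    [vector [R$1$1 - R$3$3, R$1$2,           R$1$3, R$2$3],
     vector [- R$1$2,       R$1$1 - R$3$3,   R$2$3, - R$1$3],
     vector [0,             0,               0,     0],
     vector [0,             0,               0,     0]]"
  have br: "bilinear g4_10"
    using lie_bracket_g4_10 by (simp add: lie_bracket_def)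
  have Ric: "?Ric x = R *v x" for x
    using linear_ricci_operator[OF assms(1) br] by (simp add: assms(2) matrix_works)
  note eq_iff = matrix_eq_mat_plus_iff[OF Ric]
  \<comment> \<open>The shape of \<open>D\<close> meets the criterion for every \<open>R\<close>;
    \<open>conds\<close> enters only through the decomposition of \<open>R\<close> below.\<close>
  have D: "lie_derivation g4_10 ((*v) D)"
    by (simp add: lie_derivation_g4_10_iff D_def vector_4 vec_eq_iff forall_4)
  have R: "R = mat (R$4$4) + D" if conds
    using that by (simp add: conds_def D_def vec_eq_iff forall_4 vector_4 mat_def)
  have "algebraic_ricci_soliton g4_10 g \<longleftrightarrow> conds"
  proof
    assume "algebraic_ricci_soliton g4_10 g"
    then obtain \<eta> E where E: "lie_derivation g4_10 E" "\<forall>x. ?Ric x = \<eta> *\<^sub>R x + E x"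
      by (auto simp: algebraic_ricci_soliton_def)
    define M where "M = matrix E"
    have "E = (*v) M"
      using E(1) by (auto simp: M_def lie_derivation_def matrix_works)
    with E have "lie_derivation g4_10 ((*v) M)" "R = mat \<eta> + M"
      by (simp_all add: eq_iff)
    \<comment> \<open>Rows 3 and 4 of \<open>M\<close> vanish, so those of \<open>R\<close> are the
      rows of \<open>mat \<eta>\<close>. In rows 1 and 2 the scalar matrix shifts both diagonal
      entries equally, so \<open>R\<close> inherits the relations of \<open>M\<close>.\<close>
    then show conds
      by (simp add: lie_derivation_g4_10_iff conds_def mat_def)
  next
    assume conds
    from D R[OF this] show "algebraic_ricci_soliton g4_10 g"
      unfolding algebraic_ricci_soliton_def eq_iff[symmetric] by blast
  qed
  moreover have "R$4$4 = R$3$3 \<and> R = mat (R$4$4) + D \<and>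
      (\<forall>x. ?Ric x = R$4$4 *\<^sub>R x + D *v x) \<and> lie_derivation g4_10 ((*v) D)" if conds
    using R[OF that] D that eq_iff by (auto simp: conds_def)
  ultimately show ?thesis
    unfolding Let_def conds_def[symmetric] D_def[symmetric] by blast
qed

end
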